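(* Let $X_1, X_2 \subseteq \mathbb{C}(\mathbf{i_1})$ be nonempty and let $X \subseteq \mathbb{BC}$ be such that $X = X_1 \times_e X_2$. Then the boundary of $X$ is the union of three bicomplex cartesian sets: $$\partial X = (\partial X_1 \times_e X_2) \cup (X_1 \times_e \partial X_2) \cup (\partial X_1 \times_e \partial X_2).$$
   Context: The bicomplex numbers are $\mathbb{BC}=\{z_1+z_2\mathbf{i_2} \mid z_1,z_2\in\mathbb{C}(\mathbf{i_1})\}$, where $\mathbb{C}(\mathbf{i_1})=\{x+y\mathbf{i_1}\mid x,y\in\mathbb{R}\}$ is the field of complex numbers with imaginary unit $\mathbf{i_1}$; $\mathbf{i_1}^2=\mathbf{i_2}^2=-1$, $\mathbf{i_1}\mathbf{i_2}=\mathbf{i_2}\mathbf{i_1}=\mathbf{j}$, $\mathbf{j}^2=1$. The norm is $\|z_1+z_2\mathbf{i_2}\|=\sqrt{|z_1|^2+|z_2|^2}$, and $\mathbb{BC}$ carries the corresponding (Euclidean) topology. Put $\mathbf{e_1}=\frac{1+\mathbf{j}}{2}$, $\mathbf{e_2}=\frac{1-\mathbf{j}}{2}$; every bicomplex number is uniquely written $z_1+z_2\mathbf{i_2}=(z_1-z_2\mathbf{i_1})\mathbf{e_1}+(z_1+z_2\mathbf{i_1})\mathbf{e_2}$. For $X_1,X_2\subseteq\mathbb{C}(\mathbf{i_1})$, $X_1\times_e X_2:=\{w_1\mathbf{e_1}+w_2\mathbf{e_2}\mid w_1\in X_1,\ w_2\in X_2\}\subseteq\mathbb{BC}$ (empty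 if $X_1$ or $X_2$ is empty). The boundary $\partial$ is the topological boundary, taken in $\mathbb{C}(\mathbf{i_1})$ for $X_1,X_2$ and in $\mathbb{BC}$ for $X$. *)

theory Defs
  imports "HOL-Analysis.Analysis"
begin

text \<open>
  The field \<open>\<complex>(i\<^sub>1)\<close> is the library type \<^typ>\<open>complex\<close>; \<open>Bicomplex z\<^sub>1 z\<^sub>2\<close> stands for \<open>z\<^sub>1 + z\<^sub>2 i\<^sub>2\<close>.
\<close>

datatype bicomplex = Bicomplex (bc_fst: complex) (bc_snd: complex)

lemma bicomplex_eq_iff: "x = y \<longleftrightarrow> bc_fst x = bc_fst y \<and> bc_snd x = bc_snd y"
  by (cases x; cases y) simp

instantiation bicomplex :: comm_ring_1
begin

definition "0 = Bicomplex 0 0"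

definition "1 = Bicomplex 1 0"

definition "x + y = Bicomplex (bc_fst x + bc_fst y) (bc_snd x + bc_snd y)"

definition "- x = Bicomplex (- bc_fst x) (- bc_snd x)"

definition "x - y = Bicomplex (bc_fst x - bc_fst y) (bc_snd x - bc_snd y)"

definition "x * y = Bicomplex (bc_fst x * bc_fst y - bc_snd x * bc_snd y)
                              (bc_fst x * bc_snd y + bc_snd x * bc_fst y)"

instance
  by standard
    (simp_all add: zero_bicomplex_def one_bicomplex_def plus_bicomplex_def uminus_bicomplex_def
      minus_bicomplex_def times_bicomplex_def algebra_simps)

end

instantiation bicomplex :: real_vector
begin

definition "r *\<^sub>R x = Bicomplex (r *\<^sub>R bc_fst x) (r *\<^sub>R bc_snd x)"

instance
  by standard (simp_all add: scaleR_bicomplex_def plus_bicomplex_def algebra_simps)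

end

text \<open>
  The norm is not submultiplicative (\<open>\<parallel>e\<^sub>1\<^sup>2\<parallel> = \<parallel>e\<^sub>1\<parallel> = 1 / \<surd>2\<close>), hence
  \<^class>\<open>real_normed_vector\<close> but not \<^class>\<open>real_normed_algebra\<close>.
\<close>

instantiation bicomplex :: real_normed_vector
begin

definition "norm x = sqrt ((cmod (bc_fst x))\<^sup>2 + (cmod (bc_snd x))\<^sup>2)"

definition "sgn x = x /\<^sub>R norm (x :: bicomplex)"

definition "dist x y = norm (x - y :: bicomplex)"

definition "(uniformity :: (bicomplex \<times> bicomplex) filter)
  = (INF e\<in>{0<..}. principal {(x, y). dist x y < e})"

definition "open (U :: bicomplex set)
  \<longleftrightarrow> (\<forall>x\<in>U. eventually (\<lambda>(x', y). x' = x \<longrightarrow> y \<in> U) uniformity)"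

instance
proof
  fix a :: real and x y :: bicomplex and U :: "bicomplex set"
  show "sgn x = x /\<^sub>R norm x"
    by (rule sgn_bicomplex_def)
  show "dist x y = norm (x - y)"
    by (rule dist_bicomplex_def)
  show "(uniformity :: (bicomplex \<times> bicomplex) filter)
      = (INF e\<in>{0<..}. principal {(x, y). dist x y < e})"
    by (rule uniformity_bicomplex_def)
  show "open U \<longleftrightarrow> (\<forall>x\<in>U. eventually (\<lambda>(x', y). x' = x \<longrightarrow> y \<in> U) uniformity)"
    by (rule open_bicomplex_def)
  show "norm x = 0 \<longleftrightarrow> x = 0"
    by (simp add: norm_bicomplex_def zero_bicomplex_def bicomplex_eq_iff)
  show "norm (a *\<^sub>R x) = \<bar>a\<bar> * norm x"
    by (simp add: norm_bicomplex_def scaleR_bicomplex_def power_mult_distrib real_sqrt_mult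
        flip: distrib_left)
  show "norm (x + y) \<le> norm x + norm y"
    using norm_triangle_ineq[of "(bc_fst x, bc_snd x)" "(bc_fst y, bc_snd y)"]
    by (simp add: norm_bicomplex_def plus_bicomplex_def norm_Pair)
qed

end

definition bc_of_complex :: "complex \<Rightarrow> bicomplex"
  where "bc_of_complex z = Bicomplex z 0"

definition bc_i1 :: bicomplex (\<open>\<i>\<^sub>1\<close>)
  where "\<i>\<^sub>1 = bc_of_complex \<i>"

definition bc_i2 :: bicomplex (\<open>\<i>\<^sub>2\<close>)
  where "\<i>\<^sub>2 = Bicomplex 0 1"

definition bc_j :: bicomplex (\<open>\<j>\<close>)
  where "\<j> = \<i>\<^sub>1 * \<i>\<^sub>2"

definition bc_e1 :: bicomplex (\<open>\<e>\<^sub>1\<close>)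
  where "\<e>\<^sub>1 = (1 + \<j>) /\<^sub>R 2"

definition bc_e2 :: bicomplex (\<open>\<e>\<^sub>2\<close>)
  where "\<e>\<^sub>2 = (1 - \<j>) /\<^sub>R 2"

definition bc_cartesian :: "complex set \<Rightarrow> complex set \<Rightarrow> bicomplex set"  (infixr \<open>\<times>\<^sub>e\<close> 80)
  where "X1 \<times>\<^sub>e X2 =
    {bc_of_complex w1 * \<e>\<^sub>1 + bc_of_complex w2 * \<e>\<^sub>2 | w1 w2. w1 \<in> X1 \<and> w2 \<in> X2}"

lemma Bicomplex_conv: "Bicomplex z1 z2 = bc_of_complex z1 + bc_of_complex z2 * \<i>\<^sub>2"
  by (simp add: bc_of_complex_def bc_i2_def plus_bicomplex_def times_bicomplex_def)

lemma bicomplex_units: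
  "\<i>\<^sub>1 * \<i>\<^sub>1 = -1" "\<i>\<^sub>2 * \<i>\<^sub>2 = -1" "\<i>\<^sub>1 * \<i>\<^sub>2 = \<j>" "\<i>\<^sub>2 * \<i>\<^sub>1 = \<j>" "\<j> * \<j> = 1"
  by (simp_all add: bc_i1_def bc_i2_def bc_j_def bc_of_complex_def times_bicomplex_def
      one_bicomplex_def uminus_bicomplex_def)

lemma bicomplex_idempotent_form:
  "bc_of_complex w1 * \<e>\<^sub>1 + bc_of_complex w2 * \<e>\<^sub>2
    = Bicomplex ((w1 + w2) / 2) (\<i> * (w1 - w2) / 2)"
  by (simp add: bc_e1_def bc_e2_def bc_j_def bc_i1_def bc_i2_def bc_of_complex_def
      times_bicomplex_def plus_bicomplex_def minus_bicomplex_def one_bicomplex_def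
      scaleR_bicomplex_def scaleR_conv_of_real field_simps)

lemma bicomplex_idempotent_repr:
  "bc_of_complex z1 + bc_of_complex z2 * \<i>\<^sub>2
    = bc_of_complex (z1 - z2 * \<i>) * \<e>\<^sub>1 + bc_of_complex (z1 + z2 * \<i>) * \<e>\<^sub>2"
  unfolding bicomplex_idempotent_form Bicomplex_conv[symmetric]
  by (simp add: field_simps)

end

theory Submission
  imports Defs
begin

text \<open>The idempotent coordinates \<open>bc_idem\<close> form a homeomorphism from the plane
  squared onto the bicomplex numbers that turns ordinary products into
  \<open>\<times>\<^sub>e\<close> (\<open>homeomorphic_map_bc_idem\<close>,
  \<open>bc_cartesian_eq_image\<close>). Boundaries are preserved by homeomorphisms, so the claim
  reduces to the boundary of an ordinary product, given by \<open>frontier_Times\<close>; writing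
  each closure there as the set together with its boundary yields the three pieces.\<close>

lemma norm_Bicomplex: "norm (Bicomplex a b) = norm (a, b)"
  by (simp add: norm_bicomplex_def norm_Pair)

lemma continuous_on_Bicomplex [continuous_intros]:
  fixes f g :: "'a::topological_space \<Rightarrow> complex"
  assumes "continuous_on S f" "continuous_on S g"
  shows "continuous_on S (\<lambda>x. Bicomplex (f x) (g x))"
proof -
  \<comment> \<open>By \<open>norm_Bicomplex\<close> this map is a linear isometry, hence the bound
    1.\<close>
  have "bounded_linear (\<lambda>p. Bicomplex (fst p) (snd p))"
    by (rule bounded_linear_intro[where K = 1])
      (simp_all add: norm_Bicomplex plus_bicomplex_def scaleR_bicomplex_def)
  from bounded_linear.continuous_on[OF this continuous_on_Pair[OF assms]]
  show ?thesis by simp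
qed

lemma bounded_linear_bc_fst: "bounded_linear bc_fst"
  and bounded_linear_bc_snd: "bounded_linear bc_snd"
  by (rule bounded_linear_intro[where K = 1];
      simp add: norm_bicomplex_def plus_bicomplex_def scaleR_bicomplex_def)+

lemmas continuous_on_bc_fst [continuous_intros] =
    bounded_linear.continuous_on[OF bounded_linear_bc_fst]
  and continuous_on_bc_snd [continuous_intros] =
    bounded_linear.continuous_on[OF bounded_linear_bc_snd]

text \<open>Taking a pair as argument makes \<open>\<times>\<^sub>e\<close> the image of a library
  product set.\<close>

definition bc_idem :: "complex \<times> complex \<Rightarrow> bicomplex"
  where "bc_idem w = bc_of_complex (fst w) * \<e>\<^sub>1 + bc_of_complex (snd w) * \<e>\<^sub>2"

lemma bc_cartesian_eq_image: "X1 \<times>\<^sub>e X2 = bc_idem ` (X1 \<times> X2)"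
  by (force simp: bc_cartesian_def bc_idem_def)

lemma homeomorphic_map_bc_idem: "homeomorphic_map euclidean euclidean bc_idem"
proof -
  \<comment> \<open>The inverse is read off from \<open>bicomplex_idempotent_repr\<close>.\<close>
  let ?g = "\<lambda>x. (bc_fst x - bc_snd x * \<i>, bc_fst x + bc_snd x * \<i>)"
  have f: "bc_idem = (\<lambda>w. Bicomplex ((fst w + snd w) / 2) (\<i> * (fst w - snd w) / 2))"
    by (simp add: fun_eq_iff bc_idem_def bicomplex_idempotent_form)
  have "continuous_on UNIV bc_idem"
    unfolding f by (intro continuous_intros) auto
  moreover have "continuous_on UNIV ?g"
    by (intro continuous_intros)
  moreover have "?g (bc_idem w) = w" for w
    by (simp add: f prod_eq_iff field_simps)
  moreover have "bc_idem (?g x) = x" for x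
    by (simp add: f bicomplex_eq_iff field_simps)
  ultimately show ?thesis
    by (auto simp: homeomorphic_map_maps homeomorphic_maps_def simp del: prod.inject
        intro!: exI[of _ ?g])
qed

lemma frontier_bc_idem_image: "frontier (bc_idem ` S) = bc_idem ` frontier S"
  using homeomorphic_map_frontier_of[OF homeomorphic_map_bc_idem, of S] by simp

text \<open>Closure and interior both commute with products, and a point of the closure misses the
  interior of the product exactly when one of its coordinates misses the corresponding
  interior.\<close>

lemma frontier_Times:
  "frontier (S \<times> T) = frontier S \<times> closure T \<union> closure S \<times> frontier T"
  by (auto simp: frontier_def closure_Times interior_Times)

theorem theorem5:
  fixes X1 X2 :: "complex set" and X :: "bicomplex set"
  assumes "X1 \<noteq> {}" and "X2 \<noteq> {}"
    and "X = X1 \<times>\<^sub>e X2"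
  shows "frontier X =
    (frontier X1 \<times>\<^sub>e X2) \<union> (X1 \<times>\<^sub>e frontier X2) \<union> (frontier X1 \<times>\<^sub>e frontier X2)"
proof -
  have "frontier (X1 \<times> X2) =
      (frontier X1 \<times> X2) \<union> (X1 \<times> frontier X2) \<union> (frontier X1 \<times> frontier X2)"
    \<comment> \<open>Once the closures are expanded, both terms of \<open>frontier_Times\<close>
      contribute the same piece \<open>frontier X1 \<times> frontier X2\<close>.\<close>
    by (auto simp: frontier_Times closure_Un_frontier)
  then show ?thesis
    by (simp add: assms(3) bc_cartesian_eq_image frontier_bc_idem_image image_Un)
qed

end
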